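(* Let $G$ be a graph (parallel edges allowed, no loops), let $\delta$ be an infinite cardinal, and let $a,b \in V(G)$ be two distinct vertices for which there are $\delta$ pairwise edge-disjoint $a{-}b$ paths each of length at most $p$, for some $p \in \mathbb{N}$. Then there exist $\delta$ pairwise edge-disjoint $a{-}b$ paths in $G$ that are pairwise order-compatible.
   Context: Graphs may have parallel edges but no loops. The length of a path is its number of edges. Two $a{-}b$ paths are order-compatible if their common vertices occur in the same order when travelling along each of them from $a$ to $b$. *)

theory Defs
  imports Main
begin

unbundle cardinal_syntax

record ('v, 'e) multigraph =
  verts :: "'v set"
  edges :: "'e set"
  ends :: "'e \<Rightarrow> 'v set"

text \<open>Edges are named objects with exactly two ends, so parallel edges are allowed and loops are
  not. Vertex set and edge set may be infinite.\<close>

definition wf_multigraph :: "('v, 'e) multigraph \<Rightarrow> bool" where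
  "wf_multigraph G \<longleftrightarrow> (\<forall>e \<in> edges G. ends G e \<subseteq> verts G \<and> card (ends G e) = 2)"

text \<open>A path, traversed from one of its ends to the other, is the pair of its vertex sequence and
  its edge sequence; the latter is needed because of parallel edges.\<close>

type_synonym ('v, 'e) mpath = "'v list \<times> 'e list"

abbreviation path_verts :: "('v, 'e) mpath \<Rightarrow> 'v list" where
  "path_verts \<equiv> fst"

abbreviation path_edges :: "('v, 'e) mpath \<Rightarrow> 'e list" where
  "path_edges \<equiv> snd"

definition path_between :: "('v, 'e) multigraph \<Rightarrow> 'v \<Rightarrow> 'v \<Rightarrow> ('v, 'e) mpath \<Rightarrow> bool" where
  "path_between G a b P \<longleftrightarrow>
     length (path_verts P) = Suc (length (path_edges P)) \<and>
     distinct (path_verts P) \<and>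
     set (path_verts P) \<subseteq> verts G \<and>
     set (path_edges P) \<subseteq> edges G \<and>
     (\<forall>i < length (path_edges P).
        ends G (path_edges P ! i) = {path_verts P ! i, path_verts P ! Suc i}) \<and>
     hd (path_verts P) = a \<and> last (path_verts P) = b"

definition path_length :: "('v, 'e) mpath \<Rightarrow> nat" where
  "path_length P = length (path_edges P)"

definition edge_disjoint :: "('v, 'e) mpath \<Rightarrow> ('v, 'e) mpath \<Rightarrow> bool" where
  "edge_disjoint P Q \<longleftrightarrow> set (path_edges P) \<inter> set (path_edges Q) = {}"

definition precedes_on :: "('v, 'e) mpath \<Rightarrow> 'v \<Rightarrow> 'v \<Rightarrow> bool" where
  "precedes_on P x y \<longleftrightarrow>
     (\<exists>i j. i < j \<and> j < length (path_verts P) \<and> path_verts P ! i = x \<and> path_verts P ! j = y)"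

definition order_compatible :: "('v, 'e) mpath \<Rightarrow> ('v, 'e) mpath \<Rightarrow> bool" where
  "order_compatible P Q \<longleftrightarrow>
     (\<forall>x \<in> set (path_verts P) \<inter> set (path_verts Q). \<forall>y \<in> set (path_verts P) \<inter> set (path_verts Q).
        precedes_on P x y \<longleftrightarrow> precedes_on Q x y)"

end

theory Submission
  imports Defs "HOL-Library.Disjoint_Sets"
begin

text \<open>
  It suffices to find \<open>\<delta>\<close> of the given paths, all of the same length, such that a vertex on two of
  them has the same position on both. Treating the finitely many pairs of positions one after the
  other, this reduces to a statement about two functions \<open>g\<close>, \<open>h\<close> that differ everywhere on an
  infinite set \<open>T\<close>: some subset of the same cardinality has disjoint images under \<open>g\<close> and \<open>h\<close>.

  If \<open>t \<mapsto> (g t, h t)\<close> is injective, take a maximal subset \<open>M\<close> with disjoint images and let \<open>C\<close> be the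
  union of these images. If \<open>M\<close> is smaller than \<open>T\<close>, then so is \<open>C \<times> C\<close>, hence all but fewer
  than \<open>|T|\<close> of the \<open>t\<close> have exactly one of \<open>g t\<close>, \<open>h t\<close> in \<open>C\<close>, and one of the two alternatives
  occurs \<open>|T|\<close> times.

  In general, choose a transversal \<open>R\<close> of the fibres of \<open>t \<mapsto> (g t, h t)\<close>. If \<open>R\<close> is smaller than
  \<open>T\<close>, then some \<open>D \<subseteq> R\<close> has the property that the fibres over any subset of \<open>D\<close> of full cardinality
  have total size \<open>|T|\<close>, and the injective case applies to \<open>D\<close>.
\<close>

section \<open>Subsets of full cardinality\<close>

abbreviation full_subset :: "'a set \<Rightarrow> 'a set \<Rightarrow> bool" where
  "full_subset X T \<equiv> X \<subseteq> T \<and> |X| =o |T|"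

lemma full_subset_refl: "full_subset T T"
  by (simp add: card_of_refl)

lemma full_subset_trans:
  assumes "full_subset Y X" and "full_subset X T"
  shows "full_subset Y T"
  using assms ordIso_transitive by blast

lemma full_subset_infinite:
  assumes "infinite T" and "full_subset X T"
  shows "infinite X"
  using assms card_of_ordIso_finite by blast

lemma not_full_subset_ordLess:
  assumes "X \<subseteq> T" and "\<not> full_subset X T"
  shows "|X| <o |T|"
  using assms card_of_mono1[OF assms(1)] by (auto simp: ordLeq_iff_ordLess_or_ordIso)

lemma card_of_finite_ordLess_infinite:
  assumes "finite A" and "infinite B"
  shows "|A| <o |B|"
  using assms by (intro finite_ordLess_infinite card_of_Well_order) (simp_all add: Field_card_of)

lemma card_of_Times_ordLess_infinite:
  assumes "infinite C" and "|A| <o |C|" and "|B| <o |C|"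
  shows "|A \<times> B| <o |C|"
proof (cases "finite (A <+> B)")
  case True
  then have "finite (A \<times> B)" by simp
  then show ?thesis using assms(1) by (rule card_of_finite_ordLess_infinite)
next
  case False
  then have "|A \<times> B| \<le>o |A <+> B|"
    by (intro card_of_Times_ordLeq_infinite_Field)
      (simp_all add: Field_card_of card_of_card_order_on card_of_Plus1 card_of_Plus2)
  also have "|A <+> B| <o |C|" using assms by (rule card_of_Plus_ordLess_infinite)
  finally show ?thesis .
qed

lemma card_of_UN_finite_ordLess:
  assumes "infinite B" and "finite I" and "\<And>i. i \<in> I \<Longrightarrow> |A i| <o |B|"
  shows "|\<Union>i\<in>I. A i| <o |B|"
  using assms(2,3)
proof (induction I)
  case empty
  then show ?case using card_of_finite_ordLess_infinite[OF _ assms(1), of "{}"] by simp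
next
  case (insert i I)
  then have "|A i \<union> \<Union> (A ` I)| <o |B|" by (intro card_of_Un_ordLess_infinite[OF assms(1)]) auto
  then show ?case by simp
qed

lemma ex_full_subset_finite_UN:
  assumes "infinite T" and "finite I" and "\<And>i. i \<in> I \<Longrightarrow> A i \<subseteq> T" and "|\<Union>i\<in>I. A i| =o |T|"
  shows "\<exists>i\<in>I. full_subset (A i) T"
proof (rule ccontr)
  assume "\<not> ?thesis"
  then have "|\<Union>i\<in>I. A i| <o |T|"
    using assms(1-3) by (intro card_of_UN_finite_ordLess not_full_subset_ordLess) auto
  with assms(4) show False using not_ordLess_ordIso by blast
qed

lemma ex_full_fibre:
  assumes "infinite T" and "finite (f ` T)"
  obtains c where "full_subset {t \<in> T. f t = c} T"
proof -
  have "(\<Union>c\<in>f ` T. {t \<in> T. f t = c}) = T" by auto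
  then have "\<exists>c\<in>f ` T. full_subset {t \<in> T. f t = c} T"
    using card_of_refl[of T] by (intro ex_full_subset_finite_UN[OF assms]) auto
  with that show thesis by blast
qed

lemma ex_full_subset_finite_Ball:
  assumes "finite I"
    and "\<And>i X. i \<in> I \<Longrightarrow> full_subset X T \<Longrightarrow> \<exists>Y. full_subset Y X \<and> P i Y"
    and "\<And>i X Y. i \<in> I \<Longrightarrow> P i X \<Longrightarrow> Y \<subseteq> X \<Longrightarrow> P i Y"
  shows "\<exists>X. full_subset X T \<and> (\<forall>i\<in>I. P i X)"
  using assms
proof (induction I)
  case empty
  show ?case using full_subset_refl[of T] by blast
next
  case (insert i I)
  have "\<exists>X. full_subset X T \<and> (\<forall>j\<in>I. P j X)"
    by (rule insert.IH) (use insert.prems in blast)+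
  then obtain X where X: "full_subset X T" and P: "\<And>j. j \<in> I \<Longrightarrow> P j X" by blast
  from insert.prems(1)[OF insertI1 X] obtain Y where Y: "full_subset Y X" "P i Y" by blast
  have "P j Y" if "j \<in> insert i I" for j
    using that Y P insert.prems(2)[of j X Y] by blast
  with full_subset_trans[OF Y(1) X] show ?case by blast
qed

section \<open>Cofinal subsets\<close>

definition cofinal_on :: "('a \<Rightarrow> 'a \<Rightarrow> bool) \<Rightarrow> 'a set \<Rightarrow> 'a set \<Rightarrow> bool" where
  "cofinal_on r A D \<longleftrightarrow> D \<subseteq> A \<and> (\<forall>a\<in>A. \<exists>x\<in>D. r a x)"

lemma cofinal_on_trans:
  assumes "transp_on A r" and S: "cofinal_on r A S" and X: "cofinal_on r S X"
  shows "cofinal_on r A X"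
  unfolding cofinal_on_def
proof (intro conjI ballI)
  show "X \<subseteq> A" using S X by (auto simp: cofinal_on_def)
  fix a assume "a \<in> A"
  with S obtain s where s: "s \<in> S" "r a s" by (auto simp: cofinal_on_def)
  with X obtain x where x: "x \<in> X" "r s x" by (auto simp: cofinal_on_def)
  have "s \<in> A" "x \<in> A" using S X s(1) x(1) by (auto simp: cofinal_on_def)
  with assms(1) \<open>a \<in> A\<close> s(2) x show "\<exists>x\<in>X. r a x" by (blast dest: transp_onD)
qed

lemma ex_minimal_card_set:
  assumes "P (A :: 'a set)"
  obtains S where "P S" and "\<And>R. P R \<Longrightarrow> |S| \<le>o |R|"
proof -
  have "wf (inv_image ordLess (\<lambda>S :: 'a set. |S| ))" by (rule wf_inv_image[OF wf_ordLess])
  from wfE_min'[OF this, of "Collect P"] assms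
  obtain S where "P S" "\<And>R. |R| <o |S| \<Longrightarrow> \<not> P R"
    by (auto simp: inv_image_def)
  with that show thesis by (metis not_ordLess_iff_ordLeq card_of_Well_order)
qed

lemma Card_order_ordIso_subset_cofinal:
  assumes r: "Card_order r" and X: "X \<subseteq> Field r" "|X| =o r" and a: "a \<in> Field r"
  shows "\<exists>x\<in>X. (a, x) \<in> r"
proof (rule ccontr)
  assume not_above: "\<not> ?thesis"
  have "Well_order r" using r by (simp add: card_order_on_def)
  then have "(x, a) \<in> r \<and> x \<noteq> a" if "x \<in> X" for x
    using not_above that X(1) a unfolding order_on_defs total_on_def refl_on_def by (metis subsetD)
  then have "X \<subseteq> underS r a" unfolding underS_def by auto
  then have "|X| \<le>o |underS r a|" by (rule card_of_mono1)
  also have "|underS r a| <o r" using r a by (rule card_of_underS)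
  finally show False using X(2) not_ordLess_ordIso by blast
qed

text \<open>The running maxima along a well-order are cofinal, and a set of them is as soon as it is
  unbounded in the well-order.\<close>

definition running_maxima :: "'a rel \<Rightarrow> ('a \<Rightarrow> 'a \<Rightarrow> bool) \<Rightarrow> 'a set" where
  "running_maxima w r = {x \<in> Field w. \<forall>y \<in> underS w x. \<not> r x y}"

lemma cofinal_on_running_maxima:
  assumes w: "Well_order w" and "reflp_on (Field w) r" and "transp_on (Field w) r"
  shows "cofinal_on r (Field w) (running_maxima w r)"
  unfolding cofinal_on_def
proof (intro conjI ballI)
  show "running_maxima w r \<subseteq> Field w" unfolding running_maxima_def by blast
  fix a assume a: "a \<in> Field w"
  have "wf (w - Id)" using w by (simp add: well_order_on_def)
  moreover have "a \<in> {x \<in> Field w. r a x}" using a assms(2) by (simp add: reflp_onD)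
  ultimately obtain x where "x \<in> {x \<in> Field w. r a x}"
    and least: "\<And>y. (y, x) \<in> w - Id \<Longrightarrow> y \<notin> {x \<in> Field w. r a x}"
    by (rule wfE_min) blast
  then have x: "x \<in> Field w" "r a x" by simp_all
  have "\<not> r x y" if "y \<in> underS w x" for y
  proof
    assume "r x y"
    moreover have y: "y \<in> Field w" "(y, x) \<in> w - Id"
      using that unfolding underS_def Field_def by auto
    ultimately have "r a y" using a x assms(3) by (blast dest: transp_onD)
    with least y show False by blast
  qed
  with x show "\<exists>x\<in>running_maxima w r. r a x" unfolding running_maxima_def by blast
qed

lemma running_maxima_mono:
  assumes "reflp_on (Field w) r" and "totalp_on (Field w) r"
    and "(a, x) \<in> w" and "x \<in> running_maxima w r"
  shows "r a x"
proof (cases "a = x")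
  case True
  then show ?thesis using assms(1,3) by (auto simp: reflp_on_def Field_def)
next
  case False
  then have "\<not> r x a" using assms(3,4) by (auto simp: running_maxima_def underS_def)
  moreover have "a \<in> Field w" "x \<in> Field w" using assms(3) by (auto simp: Field_def)
  ultimately show ?thesis using False assms(2) by (blast dest: totalp_onD)
qed

lemma ex_subset_full_subsets_cofinal:
  assumes r: "reflp_on A r" "transp_on A r" "totalp_on A r"
  obtains D where "\<And>X. full_subset X D \<Longrightarrow> cofinal_on r A X"
proof -
  have "cofinal_on r A A" using r(1) by (auto simp: cofinal_on_def reflp_on_def)
  then obtain S where S: "cofinal_on r A S" and min: "\<And>R. cofinal_on r A R \<Longrightarrow> |S| \<le>o |R|"
    by (rule ex_minimal_card_set[of "cofinal_on r A"]) blast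
  define D where "D = running_maxima ( |S| ) r"
  have S_subset: "S \<subseteq> A" and D_subset: "D \<subseteq> S"
    using S by (auto simp: cofinal_on_def D_def running_maxima_def Field_card_of)
  have r_on_field: "reflp_on (Field |S| ) r" "transp_on (Field |S| ) r" "totalp_on (Field |S| ) r"
    using r S_subset
    by (auto simp: Field_card_of intro: reflp_on_subset transp_on_subset totalp_on_subset)
  have "cofinal_on r S D"
    using cofinal_on_running_maxima[OF card_of_Well_order r_on_field(1,2)]
    by (simp add: D_def Field_card_of)
  with r(2) S have "cofinal_on r A D" by (rule cofinal_on_trans)
  then have D_full: "full_subset D S"
    using D_subset min card_of_mono1[OF D_subset] by (simp add: ordIso_iff_ordLeq)
  have cofinal: "cofinal_on r S X" if "full_subset X D" for X
    unfolding cofinal_on_def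
  proof (intro conjI ballI)
    have X: "full_subset X S" using that D_full by (rule full_subset_trans)
    then show "X \<subseteq> S" by simp
    fix s assume "s \<in> S"
    with X obtain x where x: "x \<in> X" "(s, x) \<in> |S|"
      using Card_order_ordIso_subset_cofinal[OF card_of_Card_order, of X S s]
      by (auto simp: Field_card_of)
    moreover have "x \<in> running_maxima ( |S| ) r" using that x(1) by (auto simp: D_def)
    ultimately show "\<exists>x\<in>X. r s x" using running_maxima_mono[OF r_on_field(1,3)] by blast
  qed
  show thesis by (rule that) (rule cofinal_on_trans[OF r(2) S cofinal])
qed

lemma card_of_UN_cofinal:
  assumes inf: "infinite (\<Union>a\<in>A. F a)" and A: "|A| <o |\<Union>a\<in>A. F a|"
    and X: "cofinal_on (\<lambda>a b. |F a| \<le>o |F b| ) A X"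
  shows "|\<Union>x\<in>X. F x| =o |\<Union>a\<in>A. F a|"
proof (rule ccontr)
  assume "\<not> ?thesis"
  then have less: "|\<Union>x\<in>X. F x| <o |\<Union>a\<in>A. F a|"
    using X by (intro not_full_subset_ordLess) (auto simp: cofinal_on_def)
  have "|F a| \<le>o |\<Union>x\<in>X. F x|" if a: "a \<in> A" for a
  proof -
    obtain x where x: "x \<in> X" "|F a| \<le>o |F x|" using X a by (auto simp: cofinal_on_def)
    note x(2)
    also have "|F x| \<le>o |\<Union>x\<in>X. F x|" using x(1) by (intro card_of_mono1) blast
    finally show ?thesis .
  qed
  then have "|SIGMA a:A. F a| \<le>o |A \<times> (\<Union>x\<in>X. F x)|" by (intro card_of_Sigma_mono1) blast
  with card_of_UNION_Sigma have "|\<Union>a\<in>A. F a| \<le>o |A \<times> (\<Union>x\<in>X. F x)|"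
    by (rule ordLeq_transitive)
  also have "|A \<times> (\<Union>x\<in>X. F x)| <o |\<Union>a\<in>A. F a|"
    using inf A less by (rule card_of_Times_ordLess_infinite)
  finally show False using ordLess_irreflexive by blast
qed

text \<open>For singular \<open>|\<Union>a\<in>A. F a|\<close>, the set \<open>D\<close> plays the role of a cofinal sequence of length the
  cofinality; no case distinction on regularity is needed.\<close>

lemma ex_subset_full_subsets_UN:
  assumes "infinite (\<Union>a\<in>A. F a)" and "|A| <o |\<Union>a\<in>A. F a|"
  obtains D where "D \<subseteq> A" and "\<And>X. full_subset X D \<Longrightarrow> |\<Union>x\<in>X. F x| =o |\<Union>a\<in>A. F a|"
proof -
  let ?r = "\<lambda>a b. |F a| \<le>o |F b|"
  have "reflp_on A ?r" by (intro reflp_onI ordLeq_reflexive card_of_Well_order)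
  moreover have "transp_on A ?r" by (rule transp_onI) (rule ordLeq_transitive)
  moreover have "totalp_on A ?r" by (intro totalp_onI ordLeq_total card_of_Well_order)
  ultimately obtain D where D: "\<And>X. full_subset X D \<Longrightarrow> cofinal_on ?r A X"
    using ex_subset_full_subsets_cofinal by blast
  show thesis
  proof (rule that)
    show "D \<subseteq> A" using D[OF full_subset_refl] by (simp add: cofinal_on_def)
    show "|\<Union>x\<in>X. F x| =o |\<Union>a\<in>A. F a|" if "full_subset X D" for X
      using assms D[OF that] by (rule card_of_UN_cofinal)
  qed
qed

section \<open>Functions that differ everywhere\<close>

lemma ex_maximal_pairwise:
  obtains M where "M \<subseteq> T" and "pairwise r M"
    and "\<And>t. t \<in> T \<Longrightarrow> (\<And>s. s \<in> M \<Longrightarrow> r s t \<and> r t s) \<Longrightarrow> t \<in> M"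
proof -
  define \<A> where "\<A> = {X. X \<subseteq> T \<and> pairwise r X}"
  have "\<Union>\<C> \<in> \<A>" if "\<C> \<in> chains \<A>" for \<C>
  proof -
    have chain: "\<C> \<subseteq> \<A>" "chain\<^sub>\<subseteq> \<C>" using that by (simp_all add: chains_def)
    then have "pairwise r (\<Union>\<C>)" by (intro pairwise_chain_Union) (auto simp: \<A>_def)
    then show ?thesis using chain(1) by (auto simp: \<A>_def)
  qed
  then obtain M where "M \<in> \<A>" and max: "\<And>X. X \<in> \<A> \<Longrightarrow> M \<subseteq> X \<Longrightarrow> X = M"
    using Zorn_Lemma[of \<A>] by blast
  then have M: "M \<subseteq> T" "pairwise r M" by (simp_all add: \<A>_def)
  have "t \<in> M" if "t \<in> T" "\<And>s. s \<in> M \<Longrightarrow> r s t \<and> r t s" for t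
  proof -
    have "insert t M \<in> \<A>" using M that by (simp add: \<A>_def pairwise_insert)
    with max[of "insert t M"] show ?thesis by blast
  qed
  with M show thesis by (rule that)
qed

lemma ex_full_subset_disjoint_images_cover:
  fixes g h :: "'t \<Rightarrow> 'v"
  assumes inf: "infinite T" and inj: "inj_on (\<lambda>t. (g t, h t)) T"
    and C: "|C| <o |T|" "\<And>t. t \<in> T \<Longrightarrow> g t \<in> C \<or> h t \<in> C"
  shows "\<exists>X. full_subset X T \<and> g ` X \<inter> h ` X = {}"
proof -
  define X where "X c = {t \<in> T. (g t \<in> C, h t \<in> C) = c}" for c
  obtain c where c: "full_subset (X c) T"
    unfolding X_def by (rule ex_full_fibre[OF inf, of "\<lambda>t. (g t \<in> C, h t \<in> C)"]) simp_all
  have "c \<noteq> (True, True)"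
  proof
    assume both: "c = (True, True)"
    have "inj_on (\<lambda>t. (g t, h t)) (X c)" using inj c by (blast intro: inj_on_subset)
    then have "|X c| \<le>o |C \<times> C|" by (rule card_of_ordLeqI) (auto simp: X_def both)
    also have "|C \<times> C| <o |T|" using inf C(1) C(1) by (rule card_of_Times_ordLess_infinite)
    finally show False using c not_ordLess_ordIso by blast
  qed
  moreover have "c \<noteq> (False, False)"
  proof
    assume "c = (False, False)"
    then have "X c = {}" using C(2) unfolding X_def by auto
    with full_subset_infinite[OF inf c] show False by simp
  qed
  ultimately have "g ` X c \<inter> h ` X c = {}" unfolding X_def by (cases c) auto
  with c show ?thesis by blast
qed

lemma ex_full_subset_disjoint_images_inj:
  fixes g h :: "'t \<Rightarrow> 'v"
  assumes inf: "infinite T" and inj: "inj_on (\<lambda>t. (g t, h t)) T"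
    and neq: "\<And>t. t \<in> T \<Longrightarrow> g t \<noteq> h t"
  shows "\<exists>X. full_subset X T \<and> g ` X \<inter> h ` X = {}"
proof -
  obtain M where M: "M \<subseteq> T" "pairwise (\<lambda>s t. g s \<noteq> h t) M"
    and max: "\<And>t. t \<in> T \<Longrightarrow> (\<And>s. s \<in> M \<Longrightarrow> g s \<noteq> h t \<and> g t \<noteq> h s) \<Longrightarrow> t \<in> M"
    by (rule ex_maximal_pairwise[of T "\<lambda>s t. g s \<noteq> h t"]) blast
  show ?thesis
  proof (cases "full_subset M T")
    case True
    moreover have "g s \<noteq> h t" if "s \<in> M" "t \<in> M" for s t
      using M neq that unfolding pairwise_def by (cases "s = t") auto
    then have "g ` M \<inter> h ` M = {}" by (simp add: disjoint_iff_not_equal)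
    ultimately show ?thesis by blast
  next
    case False
    with M(1) have "|M| <o |T|" by (rule not_full_subset_ordLess)
    then have "|g ` M \<union> h ` M| <o |T|"
      by (intro card_of_Un_ordLess_infinite inf ordLeq_ordLess_trans[OF card_of_image])
    moreover have "g t \<in> g ` M \<union> h ` M \<or> h t \<in> g ` M \<union> h ` M" if "t \<in> T" for t
      using max[OF that] by (metis UnCI image_eqI)
    ultimately show ?thesis by (rule ex_full_subset_disjoint_images_cover[OF inf inj])
  qed
qed

lemma ex_full_subset_disjoint_images_small_transversal:
  fixes g h :: "'t \<Rightarrow> 'v"
  defines "f \<equiv> \<lambda>t. (g t, h t)"
  assumes inf: "infinite T" and neq: "\<And>t. t \<in> T \<Longrightarrow> g t \<noteq> h t"
    and R: "R \<subseteq> T" "inj_on f R" "f ` T = f ` R" "|R| <o |T|"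
  shows "\<exists>X. full_subset X T \<and> g ` X \<inter> h ` X = {}"
proof -
  define F where "F x = {t \<in> T. f t = f x}" for x
  have "(\<Union>x\<in>R. F x) = T" using R(3) unfolding F_def by blast
  with inf R(4) obtain D where D: "D \<subseteq> R"
    and full: "\<And>X. full_subset X D \<Longrightarrow> |\<Union>x\<in>X. F x| =o |T|"
    using ex_subset_full_subsets_UN[of F R] by auto
  have neq_D: "g x \<noteq> h x" if "x \<in> D" for x using that D R(1) neq by blast
  obtain X where X: "|\<Union>x\<in>X. F x| =o |T|" "g ` X \<inter> h ` X = {}"
  proof (cases "finite D")
    case True
    have "\<exists>x\<in>D. full_subset (F x) T"
      by (rule ex_full_subset_finite_UN[OF inf True _ full[OF full_subset_refl]]) (simp add: F_def)
    then obtain x where "x \<in> D" "|F x| =o |T|" by blast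
    with neq_D show thesis using that[of "{x}"] by simp
  next
    case False
    have "inj_on (\<lambda>t. (g t, h t)) D" using R(2) D unfolding f_def by (rule inj_on_subset)
    from ex_full_subset_disjoint_images_inj[OF False this neq_D]
    obtain X where "full_subset X D" "g ` X \<inter> h ` X = {}" by blast
    with full show thesis by (blast intro: that)
  qed
  let ?U = "\<Union>x\<in>X. F x"
  have "g ` ?U \<subseteq> g ` X" "h ` ?U \<subseteq> h ` X" unfolding F_def f_def by auto
  with X(2) have "g ` ?U \<inter> h ` ?U = {}" by blast
  moreover have "?U \<subseteq> T" unfolding F_def by blast
  ultimately show ?thesis using X(1) by blast
qed

lemma ex_full_subset_disjoint_images:
  fixes g h :: "'t \<Rightarrow> 'v"
  assumes inf: "infinite T" and neq: "\<And>t. t \<in> T \<Longrightarrow> g t \<noteq> h t"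
  shows "\<exists>X. full_subset X T \<and> g ` X \<inter> h ` X = {}"
proof -
  let ?f = "\<lambda>t. (g t, h t)"
  obtain R where R: "R \<subseteq> T" "inj_on ?f R" "?f ` T = ?f ` R"
    using subset_image_inj[of "?f ` T" ?f T] by auto
  show ?thesis
  proof (cases "full_subset R T")
    case True
    have "g t \<noteq> h t" if "t \<in> R" for t using that R(1) neq by blast
    from ex_full_subset_disjoint_images_inj[OF full_subset_infinite[OF inf True] R(2) this]
    obtain X where "full_subset X R" "g ` X \<inter> h ` X = {}" by blast
    with full_subset_trans[OF _ True] show ?thesis by meson
  next
    case False
    with R(1) have "|R| <o |T|" by (rule not_full_subset_ordLess)
    with inf neq R show ?thesis by (rule ex_full_subset_disjoint_images_small_transversal)
  qed
qed

lemma ex_full_subset_disjoint_family_on_images: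
  assumes "finite I" and "infinite T" and inj: "\<And>t. t \<in> T \<Longrightarrow> inj_on (\<lambda>i. x i t) I"
  obtains X where "full_subset X T" and "disjoint_family_on (\<lambda>i. x i ` X) I"
proof -
  let ?K = "{(i, j) \<in> I \<times> I. i \<noteq> j}"
  let ?P = "\<lambda>(i, j) X. x i ` X \<inter> x j ` X = {}"
  have "\<exists>X. full_subset X T \<and> (\<forall>k\<in>?K. ?P k X)"
  proof (rule ex_full_subset_finite_Ball)
    show "finite ?K" by (rule finite_subset[of _ "I \<times> I"]) (auto simp: assms(1))
    fix k X assume "k \<in> ?K"
    then obtain i j where k: "k = (i, j)" "i \<in> I" "j \<in> I" "i \<noteq> j" by blast
    show "\<exists>Y. full_subset Y X \<and> ?P k Y" if X: "full_subset X T"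
    proof -
      have "x i t \<noteq> x j t" if "t \<in> X" for t
        using k inj_onD[OF inj, of t i j] X that by blast
      from ex_full_subset_disjoint_images[OF full_subset_infinite[OF assms(2) X] this]
      show ?thesis by (simp add: k(1))
    qed
    show "?P k Y" if "?P k X" "Y \<subseteq> X" for Y
      using that by (auto simp: k(1))
  qed
  then show thesis using that by (auto simp: disjoint_family_on_def)
qed

section \<open>Aligned paths\<close>

definition aligned :: "'a list \<Rightarrow> 'a list \<Rightarrow> bool" where
  "aligned xs ys \<longleftrightarrow> (\<forall>i < length xs. \<forall>j < length ys. xs ! i = ys ! j \<longrightarrow> i = j)"

lemma aligned_sym: "aligned xs ys \<Longrightarrow> aligned ys xs"
  unfolding aligned_def by metis

lemma ex_full_subset_aligned:
  assumes "infinite T" and xs: "\<And>t. t \<in> T \<Longrightarrow> distinct (xs t) \<and> length (xs t) \<le> n"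
  obtains X where "full_subset X T" and "\<And>s t. s \<in> X \<Longrightarrow> t \<in> X \<Longrightarrow> aligned (xs s) (xs t)"
proof -
  have "(\<lambda>t. length (xs t)) ` T \<subseteq> {..n}" using xs by auto
  then have "finite ((\<lambda>t. length (xs t)) ` T)" by (rule finite_subset) simp
  with assms(1) obtain m
    where T': "full_subset {t \<in> T. length (xs t) = m} T" (is "full_subset ?T' T")
    by (rule ex_full_fibre)
  have "inj_on (\<lambda>i. xs t ! i) {..<m}" if "t \<in> ?T'" for t
    using that xs by (auto intro: inj_on_nth)
  then obtain X where X: "full_subset X ?T'"
    and disj: "disjoint_family_on (\<lambda>i. (\<lambda>t. xs t ! i) ` X) {..<m}"
    by (rule ex_full_subset_disjoint_family_on_images
        [OF finite_lessThan full_subset_infinite[OF assms(1) T']])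
  show thesis
  proof (rule that)
    show "full_subset X T" using X T' by (rule full_subset_trans)
    fix s t assume "s \<in> X" "t \<in> X"
    then have len: "length (xs s) = m" "length (xs t) = m" using X by auto
    show "aligned (xs s) (xs t)"
      unfolding aligned_def
    proof (intro allI impI, rule ccontr)
      fix i j assume ij: "i < length (xs s)" "j < length (xs t)" "xs s ! i = xs t ! j" "i \<noteq> j"
      then have "(\<lambda>t. xs t ! i) ` X \<inter> (\<lambda>t. xs t ! j) ` X = {}"
        using disj len by (intro disjoint_family_onD) auto
      with ij(3) \<open>s \<in> X\<close> \<open>t \<in> X\<close> show False by blast
    qed
  qed
qed

lemma aligned_precedes_on:
  assumes "aligned (path_verts P) (path_verts Q)"
    and "x \<in> set (path_verts Q)" and "y \<in> set (path_verts Q)" and "precedes_on P x y"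
  shows "precedes_on Q x y"
proof -
  obtain i j where P: "i < j" "j < length (path_verts P)" "path_verts P ! i = x" "path_verts P ! j = y"
    using assms(4) unfolding precedes_on_def by blast
  obtain i' j' where Q: "i' < length (path_verts Q)" "path_verts Q ! i' = x"
    "j' < length (path_verts Q)" "path_verts Q ! j' = y"
    using assms(2,3) unfolding in_set_conv_nth by blast
  have "i = i'" "j = j'" using assms(1) P Q unfolding aligned_def by auto
  with P(1) Q show ?thesis unfolding precedes_on_def by blast
qed

lemma aligned_order_compatible:
  assumes "aligned (path_verts P) (path_verts Q)"
  shows "order_compatible P Q"
  unfolding order_compatible_def
  using aligned_precedes_on[OF assms] aligned_precedes_on[OF aligned_sym[OF assms]] by blast

theorem theorem1p1:
  fixes G :: "('v, 'e) multigraph"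
    and \<delta> :: "'d rel"
    and a b :: 'v
    and p :: nat
  assumes "wf_multigraph G"
    and "Card_order \<delta>" and "cinfinite \<delta>"
    and "a \<in> verts G" and "b \<in> verts G" and "a \<noteq> b"
    and "\<exists>\<P> :: ('v, 'e) mpath set.
           |\<P>| =o \<delta> \<and>
           (\<forall>P \<in> \<P>. path_between G a b P \<and> path_length P \<le> p) \<and>
           pairwise edge_disjoint \<P>"
  shows "\<exists>\<Q> :: ('v, 'e) mpath set.
           |\<Q>| =o \<delta> \<and>
           (\<forall>Q \<in> \<Q>. path_between G a b Q) \<and>
           pairwise edge_disjoint \<Q> \<and>
           pairwise order_compatible \<Q>"
proof -
  obtain \<P> :: "('v, 'e) mpath set" where card: "|\<P>| =o \<delta>"
    and path: "\<And>P. P \<in> \<P> \<Longrightarrow> path_between G a b P \<and> path_length P \<le> p"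
    and disj: "pairwise edge_disjoint \<P>"
    using assms(7) by blast
  have "infinite \<P>"
    using card_of_ordIso_finite_Field[OF assms(2) ordIso_symmetric[OF card]] assms(3)
    unfolding cinfinite_def by simp
  moreover have "distinct (path_verts P) \<and> length (path_verts P) \<le> Suc p" if "P \<in> \<P>" for P
    using path[OF that] by (simp add: path_between_def path_length_def)
  ultimately obtain \<Q> where \<Q>: "full_subset \<Q> \<P>"
    and aligned: "\<And>P Q. P \<in> \<Q> \<Longrightarrow> Q \<in> \<Q> \<Longrightarrow> aligned (path_verts P) (path_verts Q)"
    using ex_full_subset_aligned[of \<P> path_verts] by blast
  have "pairwise order_compatible \<Q>"
    by (intro pairwiseI aligned_order_compatible aligned)
  moreover have "pairwise edge_disjoint \<Q>" using disj \<Q> by (blast intro: pairwise_subset)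
  moreover have "|\<Q>| =o \<delta>" using \<Q> card ordIso_transitive by blast
  ultimately show ?thesis using \<Q> path by blast
qed

end
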